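(* Let $n$ be an integer with $|n|\ge2$. For any $W\subseteq\mathcal W$, there is a positive integer $h$ with $\gcd(h,n)=1$ such that $W(0,h)=W$ if and only if $W$ is a principal ideal in $(\mathcal W;\lesssim)$. Consequently, the closed sets with respect to $\mathrm{cl}_0$ are exactly the principal ideals of $(\mathcal W;\lesssim)$ together with $\emptyset$ and $\mathcal W$.
   Context: $\Sigma=\{0,1,\dots,|n|-1\}$, and $\mathcal W$ is the set of primitive words in $\Sigma^+$ (finite nonempty words that are not of the form $v^k$ with $k\ge2$). $(0.c_{-1}c_{-2}\ldots)_n$ denotes $\sum_{i\ge1}c_{-i}n^{-i}$ with $c_{-i}\in\Sigma$; $I_n$ is the set of all such numbers, which is $[0,1]$ if $n\ge2$ and $\left[\frac{-n}{n-1},\frac{-1}{n-1}\right]$ if $n\le-2$. For $w=c_0c_1\cdots c_{\ell-1}\in\mathcal W$ let $$\mathrm q(w)=(0.c_{\ell-1}\ldots c_0c_{\ell-1}\ldots c_0\ldots)_n=\frac{\sum_{i=0}^{\ell-1}c_in^i}{n^\ell-1},$$ and let $\mathrm h_0(w)=\dfrac{n^\ell-1}{\gcd\left(n^\ell-1,\ \sum_{i=0}^{\ell-1}c_in^i\right)}$, i.e. the denominator of the reduced form of $\mathrm q(w)$, with the sign of the gcd chosen so that $\mathrm h_0(w)>0$. For a positive integer $h$ coprime to $n$ let $$Q(0,h)=\left\{q\in I_n:\exists b\in\mathbb Z,\ q=\tfrac bh\right\},\qquad W(0,h)=\{w\in\mathcal W:\mathrm q(w)\in Q(0,h)\}.$$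 The quasiorder $\lesssim$ on $\mathcal W$ is defined by $w_1\lesssim w_2\iff\mathrm h_0(w_1)\mid\mathrm h_0(w_2)$. A principal ideal is a set of the form ${\downarrow}w=\{w'\in\mathcal W:w'\lesssim w\}$ with $w\in\mathcal W$. The closure operator $\mathrm{cl}_0$ on $\mathcal W$: for a nonempty finite $W\subseteq\mathcal W$, $\mathrm{cl}_0(W)$ is the least set of the form $W(0,h)$ ($h$ a positive integer coprime to $n$) containing $W$ (it exists and equals $W(0,\operatorname{lcm}\{\mathrm h_0(w):w\in W\})$); $\mathrm{cl}_0(\emptyset)=\emptyset$; and $\mathrm{cl}_0(W)=\mathcal W$ for infinite $W$. A set $W$ is closed if $\mathrm{cl}_0(W)=W$. *)

theory Defs
  imports Complex_Main
begin

definition digits :: "int \<Rightarrow> int set" where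
  "digits n = {0..<\<bar>n\<bar>}"

definition primitive :: "'a list \<Rightarrow> bool" where
  "primitive w \<longleftrightarrow> w \<noteq> [] \<and> \<not> (\<exists>v k. k \<ge> 2 \<and> w = concat (replicate k v))"

definition prim_words :: "int \<Rightarrow> int list set" where
  "prim_words n = {w. set w \<subseteq> digits n \<and> primitive w}"

(* The number (0.c_{-1}c_{-2}...)_n, where c_{-i} is stored as c (i - 1). *)
definition frac_val :: "int \<Rightarrow> (nat \<Rightarrow> int) \<Rightarrow> real" where
  "frac_val n c = (\<Sum>i. of_int (c i) / of_int n ^ (i + 1))"

definition I_set :: "int \<Rightarrow> real set" where
  "I_set n = {x. \<exists>c. (\<forall>i. c i \<in> digits n) \<and> x = frac_val n c}"

(* For w = c_0 c_1 ... c_{l-1} the digits after the point are c_{l-1}, ..., c_0, repeated. *)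
definition q_val :: "int \<Rightarrow> int list \<Rightarrow> real" where
  "q_val n w = frac_val n (\<lambda>i. rev w ! (i mod length w))"

definition word_num :: "int \<Rightarrow> int list \<Rightarrow> int" where
  "word_num n w = (\<Sum>i<length w. w ! i * n ^ i)"

(* The gcd on int is nonnegative, so the absolute value implements the choice of the sign
   of the gcd that makes h0 positive (n^l - 1 is negative for n < 0 and odd l). *)
definition h0 :: "int \<Rightarrow> int list \<Rightarrow> int" where
  "h0 n w = \<bar>n ^ length w - 1\<bar> div gcd (n ^ length w - 1) (word_num n w)"

definition Q0 :: "int \<Rightarrow> int \<Rightarrow> real set" where
  "Q0 n h = {q \<in> I_set n. \<exists>b::int. q = of_int b / of_int h}"

definition W0 :: "int \<Rightarrow> int \<Rightarrow> int list set" where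
  "W0 n h = {w \<in> prim_words n. q_val n w \<in> Q0 n h}"

definition word_le :: "int \<Rightarrow> int list \<Rightarrow> int list \<Rightarrow> bool" where
  "word_le n w1 w2 \<longleftrightarrow> h0 n w1 dvd h0 n w2"

definition down :: "int \<Rightarrow> int list \<Rightarrow> int list set" where
  "down n w = {w' \<in> prim_words n. word_le n w' w}"

definition principal_ideal :: "int \<Rightarrow> int list set \<Rightarrow> bool" where
  "principal_ideal n W \<longleftrightarrow> (\<exists>w \<in> prim_words n. W = down n w)"

(* LEAST is taken with respect to set inclusion. *)
definition cl0 :: "int \<Rightarrow> int list set \<Rightarrow> int list set" where
  "cl0 n W =
     (if W = {} then {}
      else if finite W then (LEAST V. W \<subseteq> V \<and> (\<exists>h>0. coprime h n \<and> V = W0 n h))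
      else prim_words n)"

definition closed0 :: "int \<Rightarrow> int list set \<Rightarrow> bool" where
  "closed0 n W \<longleftrightarrow> cl0 n W = W"

lemma summable_frac_val:
  assumes n: "\<bar>n\<bar> \<ge> 2" and c: "\<And>i. c i \<in> digits n"
  shows "summable (\<lambda>i. of_int (c i) / of_int n ^ (i + 1) :: real)"
proof (rule summable_comparison_test')
  show "summable (\<lambda>i. (1 / \<bar>of_int n\<bar> :: real) ^ i)"
    using n by (intro summable_geometric) (auto simp: divide_simps)
next
  fix i :: nat
  have N: "\<bar>real_of_int n\<bar> > 0" using n by linarith
  have "\<bar>real_of_int (c i)\<bar> \<le> \<bar>real_of_int n\<bar>"
    using c[of i] by (auto simp: digits_def)
  hence "\<bar>real_of_int (c i)\<bar> / \<bar>of_int n\<bar> ^ (i + 1) \<le> \<bar>of_int n\<bar> / \<bar>of_int n\<bar> ^ (i + 1)"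
    by (intro divide_right_mono) auto
  also have "\<dots> = (1 / \<bar>of_int n\<bar>) ^ i"
    using N by (simp add: power_divide)
  finally show "norm (of_int (c i) / of_int n ^ (i + 1) :: real) \<le> (1 / \<bar>of_int n\<bar>) ^ i"
    by (simp add: abs_mult power_abs)
qed

lemma q_val_closed_form:
  assumes n: "\<bar>n\<bar> \<ge> 2" and w: "w \<noteq> []" "set w \<subseteq> digits n"
  shows "q_val n w = of_int (word_num n w) / (of_int n ^ length w - 1)"
proof -
  define l where "l = length w"
  define c where "c = (\<lambda>i. rev w ! (i mod l))"
  define f where "f = (\<lambda>i. of_int (c i) / of_int n ^ (i + 1) :: real)"
  let ?N = "of_int n :: real"
  have l: "l > 0" using w by (simp add: l_def)
  have N0: "?N \<noteq> 0" using n by auto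
  have cd: "c i \<in> digits n" for i
  proof -
    have "c i \<in> set (rev w)" unfolding c_def using l by (intro nth_mem) (simp add: l_def)
    thus ?thesis using w by auto
  qed
  have sf: "summable f" unfolding f_def using summable_frac_val[of n c] n cd by simp
  have q: "q_val n w = suminf f"
    by (simp add: q_val_def frac_val_def f_def c_def l_def)
  have shift: "f (i + l) = f i / ?N ^ l" for i
    by (simp add: f_def c_def power_add mult_ac)
  have "suminf f = (\<Sum>i. f (i + l)) + sum f {..<l}"
    using suminf_split_initial_segment[OF sf] .
  also have "(\<Sum>i. f (i + l)) = suminf f / ?N ^ l"
    by (simp add: shift suminf_divide sf)
  finally have eq: "suminf f * (?N ^ l - 1) = ?N ^ l * sum f {..<l}"
    using N0 by (simp add: field_simps)
  have "?N ^ l * sum f {..<l} = (\<Sum>i<l. of_int (w ! (l - Suc i)) * ?N ^ (l - Suc i))"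
    unfolding sum_distrib_left
  proof (rule sum.cong)
    fix i assume "i \<in> {..<l}"
    hence i: "i < l" by simp
    have "?N ^ l = ?N ^ (l - Suc i) * ?N ^ (i + 1)"
      using i by (subst power_add [symmetric]) simp
    thus "?N ^ l * f i = of_int (w ! (l - Suc i)) * ?N ^ (l - Suc i)"
      using i N0 by (simp add: f_def c_def rev_nth l_def)
  qed simp
  also have "\<dots> = (\<Sum>i<l. of_int (w ! i) * ?N ^ i)"
    by (rule sum.nat_diff_reindex)
  also have "\<dots> = of_int (word_num n w)"
    by (simp add: word_num_def l_def)
  finally have eq2: "suminf f * (?N ^ l - 1) = of_int (word_num n w)"
    using eq by simp
  have "\<bar>?N ^ l\<bar> > 1"
    using n l by (simp add: power_abs)
  hence "?N ^ l - 1 \<noteq> 0" by auto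
  thus ?thesis using eq2 q by (simp add: field_simps l_def)
qed

end

(* The sets W(0,h) are the sets {w. h0 w dvd h}, so the first claim amounts to: every h coprime
   to n is some h0 w. For h \<ge> 2 choose an even l with h dvd n^l - 1; then (n^l - 1)/h, with the
   sign of n, has a base-n expansion with l digits, and the primitive root of that digit word
   has h0 = h.

   The second claim needs principal ideals to be finite. The rotations of a primitive word w are
   pairwise distinct words of the same length, so their q-values are pairwise distinct; they are
   all fractions with denominator h and absolute value at most 1, so length w \<le> 2 h + 1. *)

theory Submission
  imports Defs "HOL-Number_Theory.Residues"
begin

section \<open>Integer values of digit words in base n, for either sign of n\<close>

lemma word_num_Nil [simp]: "word_num n [] = 0"
  by (simp add: word_num_def)

lemma word_num_Cons [simp]: "word_num n (d # w) = d + n * word_num n w"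
  by (simp add: word_num_def sum.lessThan_Suc_shift sum_distrib_left mult_ac
           del: sum.lessThan_Suc)

lemma word_num_append:
  "word_num n (u @ v) = word_num n u + n ^ length u * word_num n v"
  by (induction u) (simp_all add: algebra_simps)

text \<open>The copies of \<open>v\<close> contribute a geometric series with ratio
  \<open>n ^ length v\<close>; clearing its denominator keeps the identity in the integers.\<close>

lemma word_num_concat_replicate:
  "word_num n (concat (replicate k v)) * (n ^ length v - 1) =
     word_num n v * (n ^ (k * length v) - 1)"
proof (induction k)
  case (Suc k)
  have "word_num n (concat (replicate (Suc k) v)) * (n ^ length v - 1) =
      word_num n v * (n ^ length v - 1) +
      n ^ length v * (word_num n (concat (replicate k v)) * (n ^ length v - 1))"
    by (simp add: word_num_append algebra_simps)
  also have "\<dots> = word_num n v * (n ^ (Suc k * length v) - 1)"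
    by (simp only: Suc.IH) (simp add: power_add algebra_simps)
  finally show ?case .
qed simp

lemma length_concat_replicate: "length (concat (replicate k v)) = k * length v"
  by (induction k) simp_all

text \<open>Two digits congruent mod n are equal because they differ by less than |n|, so the value
  determines the lowest digit, then the next, and so on.\<close>

lemma word_num_inj:
  assumes "length u = length v" "set u \<subseteq> digits n" "set v \<subseteq> digits n"
    and "word_num n u = word_num n v"
  shows "u = v"
  using assms
proof (induction u v rule: list_induct2)
  case (Cons x xs y ys)
  have xy: "\<bar>x - y\<bar> < \<bar>n\<bar>" and n: "n \<noteq> 0"
    using Cons.prems by (auto simp: digits_def)
  have "x - y = n * (word_num n ys - word_num n xs)"
    using Cons.prems by (simp add: algebra_simps)
  hence "n dvd x - y" by simp
  hence "x = y"
    using xy dvd_imp_le_int[of "x - y" n] by linarith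
  thus ?case using Cons n by simp
qed simp

lemma abs_word_num_le:
  assumes "n \<noteq> 0" "set w \<subseteq> digits n"
  shows "\<bar>word_num n w\<bar> \<le> \<bar>n\<bar> ^ length w - 1"
  using assms(2)
proof (induction w)
  case (Cons d w)
  have "\<bar>d + n * word_num n w\<bar> \<le> \<bar>d\<bar> + \<bar>n\<bar> * \<bar>word_num n w\<bar>"
    by (metis abs_mult abs_triangle_ineq)
  also have "\<dots> \<le> (\<bar>n\<bar> - 1) + \<bar>n\<bar> * (\<bar>n\<bar> ^ length w - 1)"
    using Cons by (intro add_mono mult_left_mono) (auto simp: digits_def)
  finally show ?case by (simp add: algebra_simps)
qed simp

text \<open>Reverse triangle inequality applied to \<open>n ^ length w - 1\<close>. For a nonempty
  word and |n| \<ge> 2 this is |q(w)| \<le> 1, which later confines the numerators of the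
  rotations.\<close>

lemma abs_word_num_le_period:
  assumes "n \<noteq> 0" "set w \<subseteq> digits n"
  shows "\<bar>word_num n w\<bar> \<le> \<bar>n ^ length w - 1\<bar>"
  using abs_word_num_le[OF assms] power_abs[of n "length w"] by linarith

lemma period_nonzero:
  assumes "\<bar>n\<bar> \<ge> 2" "l > 0"
  shows "n ^ l - 1 \<noteq> (0 :: int)"
proof
  assume "n ^ l - 1 = 0"
  hence "\<bar>n\<bar> ^ l = 1" by (simp flip: power_abs)
  moreover have "\<bar>n\<bar> ^ l > 1" using assms by (intro one_less_power) auto
  ultimately show False by simp
qed

text \<open>The two sums are the extreme values of words of length l: the digit at place i is 0 or
  |n| - 1, depending on the sign of n^i. Every integer in between is reached by splitting off the
  lowest digit and dividing by n, which turns the range for \<open>Suc l\<close> into the one for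
  \<open>l\<close>.\<close>

lemma exists_word_num:
  assumes n: "\<bar>n\<bar> \<ge> 2"
    and "(\<Sum>i<l. min 0 ((\<bar>n\<bar> - 1) * n ^ i)) \<le> m" "m \<le> (\<Sum>i<l. max 0 ((\<bar>n\<bar> - 1) * n ^ i))"
  shows "\<exists>w. length w = l \<and> set w \<subseteq> digits n \<and> word_num n w = m"
  using assms(2,3)
proof (induction l arbitrary: m)
  case (Suc l)
  define d m' where "d = m mod \<bar>n\<bar>" and "m' = (m - d) div n"
  define lo hi where "lo = (\<Sum>i<l. min 0 ((\<bar>n\<bar> - 1) * n ^ i))"
    and "hi = (\<Sum>i<l. max 0 ((\<bar>n\<bar> - 1) * n ^ i))"
  have d: "0 \<le> d" "d < \<bar>n\<bar>" using n by (auto simp: d_def)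
  have "\<bar>n\<bar> dvd m - d" by (simp add: d_def)
  hence m: "m = d + n * m'" by (simp add: m'_def)
  have bounds: "(\<Sum>i<l. min 0 ((\<bar>n\<bar> - 1) * n ^ Suc i)) \<le> m"
      "m \<le> \<bar>n\<bar> - 1 + (\<Sum>i<l. max 0 ((\<bar>n\<bar> - 1) * n ^ Suc i))"
    using Suc.prems n
    by (simp_all add: sum.lessThan_Suc_shift del: sum.lessThan_Suc power_Suc)
  have "lo \<le> m' \<and> m' \<le> hi"
  proof (cases "n > 0")
    case True
    have "min 0 ((\<bar>n\<bar> - 1) * n ^ Suc i) = n * min 0 ((\<bar>n\<bar> - 1) * n ^ i)"
      "max 0 ((\<bar>n\<bar> - 1) * n ^ Suc i) = n * max 0 ((\<bar>n\<bar> - 1) * n ^ i)" for i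
      using True by (simp_all add: min_mult_distrib_left max_mult_distrib_left mult_ac)
    hence "(\<Sum>i<l. min 0 ((\<bar>n\<bar> - 1) * n ^ Suc i)) = n * lo"
      "(\<Sum>i<l. max 0 ((\<bar>n\<bar> - 1) * n ^ Suc i)) = n * hi"
      by (simp_all only: lo_def hi_def sum_distrib_left)
    hence "n * lo \<le> m" "m \<le> (n - 1) + n * hi"
      using bounds n True by linarith+
    \<comment> \<open>The lowest digit shifts the bounds by less than |n|, so integrality of
      \<open>m'\<close> restores the exact range.\<close>
    hence "n * lo < n * (m' + 1)" "n * m' < n * (hi + 1)"
      using m d True by (auto simp: algebra_simps)
    thus ?thesis using True by simp
  next
    case False
    \<comment> \<open>A negative factor exchanges minimum and maximum, so \<open>lo\<close> and
      \<open>hi\<close> trade places.\<close>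
    have "min 0 ((\<bar>n\<bar> - 1) * n ^ Suc i) = n * max 0 ((\<bar>n\<bar> - 1) * n ^ i)"
      "max 0 ((\<bar>n\<bar> - 1) * n ^ Suc i) = n * min 0 ((\<bar>n\<bar> - 1) * n ^ i)" for i
      using False n by (simp_all add: min_mult_distrib_left max_mult_distrib_left mult_ac)
    hence "(\<Sum>i<l. min 0 ((\<bar>n\<bar> - 1) * n ^ Suc i)) = n * hi"
      "(\<Sum>i<l. max 0 ((\<bar>n\<bar> - 1) * n ^ Suc i)) = n * lo"
      by (simp_all only: lo_def hi_def sum_distrib_left)
    hence "n * hi \<le> m" "m \<le> (- n - 1) + n * lo"
      using bounds n False by linarith+
    hence "n * (hi + 1) < n * m'" "n * (m' + 1) < n * lo"
      using m d False by (auto simp: algebra_simps)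
    thus ?thesis using False n by (simp add: mult_less_cancel_left)
  qed
  then obtain w where "length w = l" "set w \<subseteq> digits n" "word_num n w = m'"
    using Suc.IH[of m'] by (auto simp: lo_def hi_def)
  thus ?case using d m by (intro exI[of _ "d # w"]) (auto simp: digits_def)
qed simp

text \<open>The places below the leading one can only widen the range, since their minima are \<le>
  0 and their maxima \<ge> 0. This smaller interval is all that \<open>exists_h0_eq\<close>
  needs.\<close>

lemma exists_word_num_top:
  fixes n m :: int
  assumes n: "\<bar>n\<bar> \<ge> 2" and l: "l > 0"
    and m: "min 0 ((\<bar>n\<bar> - 1) * n ^ (l - 1)) \<le> m" "m \<le> max 0 ((\<bar>n\<bar> - 1) * n ^ (l - 1))"
  shows "\<exists>w. length w = l \<and> set w \<subseteq> digits n \<and> word_num n w = m"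
proof (rule exists_word_num[OF n])
  have "(\<Sum>i\<in>{..<l} - {l - 1}. min 0 ((\<bar>n\<bar> - 1) * n ^ i)) \<le> 0"
    by (intro sum_nonpos) simp
  hence "(\<Sum>i<l. min 0 ((\<bar>n\<bar> - 1) * n ^ i)) \<le> min 0 ((\<bar>n\<bar> - 1) * n ^ (l - 1))"
    using l sum.remove[of "{..<l}" "l - 1" "\<lambda>i. min 0 ((\<bar>n\<bar> - 1) * n ^ i)"]
    by (simp only: finite_lessThan lessThan_iff)
  thus "(\<Sum>i<l. min 0 ((\<bar>n\<bar> - 1) * n ^ i)) \<le> m" using m by linarith
  have "(\<Sum>i\<in>{..<l} - {l - 1}. max 0 ((\<bar>n\<bar> - 1) * n ^ i)) \<ge> 0"
    by (intro sum_nonneg) simp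
  hence "(\<Sum>i<l. max 0 ((\<bar>n\<bar> - 1) * n ^ i)) \<ge> max 0 ((\<bar>n\<bar> - 1) * n ^ (l - 1))"
    using l sum.remove[of "{..<l}" "l - 1" "\<lambda>i. max 0 ((\<bar>n\<bar> - 1) * n ^ i)"]
    by (simp only: finite_lessThan lessThan_iff)
  thus "m \<le> (\<Sum>i<l. max 0 ((\<bar>n\<bar> - 1) * n ^ i))" using m by linarith
qed

section \<open>The reduced denominator \<open>h0\<close> and its divisibility criterion\<close>

lemma div_gcd_dvd_iff:
  fixes a b h :: int
  assumes "a \<noteq> 0"
  shows "\<bar>a\<bar> div gcd a b dvd h \<longleftrightarrow> a dvd h * b"
proof -
  define g where "g = gcd a b"
  have g: "g > 0" using assms by (simp add: g_def)
  then obtain a' b' where ab: "a = a' * g" "b = b' * g" "coprime a' b'"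
    using gcd_coprime_exists[of a b] unfolding g_def by (metis less_irrefl)
  have "\<bar>a\<bar> div g = \<bar>a'\<bar>" using g by (simp add: ab(1) abs_mult)
  moreover have "a dvd h * b \<longleftrightarrow> a' * g dvd (h * b') * g" by (simp only: ab mult.assoc)
  hence "a dvd h * b \<longleftrightarrow> a' dvd h"
    using g ab(3) by (simp add: coprime_dvd_mult_left_iff)
  ultimately show ?thesis by (simp add: g_def)
qed

text \<open>The reduced denominator of a fraction divides h exactly when h times the fraction is an
  integer. Later arguments use this criterion in place of the gcd in \<open>h0\<close>.\<close>

lemma h0_dvd_iff:
  assumes "\<bar>n\<bar> \<ge> 2" "w \<noteq> []"
  shows "h0 n w dvd h \<longleftrightarrow> n ^ length w - 1 dvd h * word_num n w"
  unfolding h0_def using assms by (intro div_gcd_dvd_iff period_nonzero) auto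

lemma h0_pos:
  assumes "\<bar>n\<bar> \<ge> 2" "w \<noteq> []"
  shows "h0 n w > 0"
proof -
  let ?N = "n ^ length w - 1"
  have "?N \<noteq> 0" using assms by (intro period_nonzero) auto
  hence "\<bar>?N\<bar> > 0" "gcd ?N (word_num n w) > 0" "gcd ?N (word_num n w) dvd \<bar>?N\<bar>" by auto
  thus ?thesis unfolding h0_def using zdvd_imp_le by (auto simp: pos_imp_zdiv_pos_iff)
qed

lemma coprime_h0:
  assumes "w \<noteq> []"
  shows "coprime (h0 n w) n"
proof -
  have "\<bar>n ^ length w - 1\<bar> = h0 n w * gcd (n ^ length w - 1) (word_num n w)"
    unfolding h0_def by simp
  hence "h0 n w dvd \<bar>n ^ length w - 1\<bar>" by (rule dvdI)
  hence "h0 n w dvd n ^ length w - 1" by (simp only: dvd_abs_iff)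
  moreover have "coprime (n ^ length w - 1) n"
    using assms coprime_diff_one_left[of "n ^ length w"] by simp
  ultimately show ?thesis using coprime_divisors dvd_refl by metis
qed

text \<open>Repeating a word leaves its periodic expansion, and hence q, unchanged. Formally, the
  two positive integers \<open>h0 n v\<close> and \<open>h0 n w\<close> have the same
  multiples.\<close>

lemma h0_concat_replicate:
  assumes n: "\<bar>n\<bar> \<ge> 2" and w: "w = concat (replicate k v)" "w \<noteq> []"
  shows "h0 n v = h0 n w"
proof -
  let ?Nw = "n ^ length w - 1" and ?Nv = "n ^ length v - 1"
  have v: "v \<noteq> []" using w by auto
  have N: "?Nw \<noteq> 0" "?Nv \<noteq> 0" using v w(2)
    by (simp_all only: period_nonzero[OF n] length_greater_0_conv simp_thms not_False_eq_True)
  have eq: "word_num n w * ?Nv = word_num n v * ?Nw"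
    using word_num_concat_replicate[of n k v] by (simp add: w length_concat_replicate)
  have "h0 n v dvd h \<longleftrightarrow> h0 n w dvd h" for h
  proof -
    \<comment> \<open>Scaling by \<open>?Nv\<close> makes \<open>eq\<close> applicable, which trades
      \<open>word_num n w\<close> for \<open>word_num n v\<close>.\<close>
    have "?Nw dvd h * word_num n w \<longleftrightarrow> ?Nw * ?Nv dvd (h * word_num n w) * ?Nv"
      using N by (simp only: dvd_mult_cancel_right) simp
    also have "(h * word_num n w) * ?Nv = ?Nw * (h * word_num n v)"
      using eq by (simp only: mult_ac)
    also have "?Nw * ?Nv dvd \<dots> \<longleftrightarrow> ?Nv dvd h * word_num n v"
      using N by (simp only: dvd_mult_cancel_left) simp
    finally show ?thesis using h0_dvd_iff[OF n] v w(2) by blast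
  qed
  thus ?thesis
    using h0_pos[OF n v] h0_pos[OF n w(2)] by (meson dvd_refl order_less_imp_le zdvd_antisym_nonneg)
qed

section \<open>Primitive roots, and realization of every denominator coprime to n\<close>

lemma exists_primitive_root:
  assumes "w \<noteq> []"
  shows "\<exists>v k. primitive v \<and> w = concat (replicate k v)"
  using assms
proof (induction "length w" arbitrary: w rule: less_induct)
  case less
  show ?case
  proof (cases "primitive w")
    case True
    thus ?thesis by (intro exI[of _ w] exI[of _ 1]) simp
  next
    case False
    then obtain u k where u: "k \<ge> 2" "w = concat (replicate k u)"
      using less.prems by (auto simp: primitive_def)
    hence "u \<noteq> []" "length u < length w"
      using less.prems by (auto simp: length_concat_replicate)
    then obtain v j where v: "primitive v" "u = concat (replicate j v)"
      using less.hyps by blast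
    have "concat (replicate i u) = concat (replicate (i * j) v)" for i
      by (induction i) (simp_all add: v(2) replicate_add)
    thus ?thesis using u v(1) by blast
  qed
qed

lemma prim_words_nonempty: "w \<in> prim_words n \<Longrightarrow> w \<noteq> []"
  by (simp add: prim_words_def primitive_def)

text \<open>Passing to the primitive root keeps \<open>h0\<close>, so a word with prescribed
  \<open>h0\<close> can be built without regard to primitivity.\<close>

lemma exists_h0_eq_of_word:
  assumes n: "\<bar>n\<bar> \<ge> 2" and w: "w \<noteq> []" "set w \<subseteq> digits n"
  shows "\<exists>v \<in> prim_words n. h0 n v = h0 n w"
proof -
  obtain v k where v: "primitive v" "w = concat (replicate k v)"
    using exists_primitive_root[OF w(1)] by blast
  have "set v \<subseteq> set w" using v(2) w(1) by (cases k) auto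
  thus ?thesis
    using v w h0_concat_replicate[OF n v(2) w(1)] by (auto simp: prim_words_def)
qed

text \<open>Euler's theorem for |n| gives the exponent \<open>totient (nat h)\<close>. Doubling
  makes it even, so that the power of |n| is also the power of n.\<close>

lemma exists_even_period:
  fixes h n :: int
  assumes "h > 0" "coprime h n"
  shows "\<exists>l>0. even l \<and> h dvd n ^ l - 1"
proof -
  define k where "k = totient (nat h)"
  have k: "k > 0" using assms by (simp add: k_def)
  have cop: "coprime (nat \<bar>n\<bar>) (nat h)"
    using assms by (simp add: coprime_commute flip: coprime_int_iff)
  have "[nat \<bar>n\<bar> ^ k = 1] (mod nat h)"
    unfolding k_def using cop by (rule euler_theorem)
  hence "[\<bar>n\<bar> ^ k = 1] (mod h)"
    using assms(1) by (simp flip: cong_int_iff)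
  hence "[(\<bar>n\<bar> ^ k) ^ 2 = 1] (mod h)" using cong_pow by fastforce
  hence "h dvd n ^ (2 * k) - 1"
    by (simp add: cong_iff_dvd_diff flip: power_mult power_abs) (simp add: power_mult mult.commute)
  thus ?thesis using k by (intro exI[of _ "2 * k"]) simp
qed

lemma exists_h0_eq:
  assumes n: "\<bar>n\<bar> \<ge> 2" and h: "h > 0" "coprime h n"
  shows "\<exists>w \<in> prim_words n. h0 n w = h"
proof (cases "h = 1")
  case True
  \<comment> \<open>For h = 1 the factor M below would be all of n^l - 1, beyond what the halving
    bound covers; the word 0 has q = 0 and denominator 1.\<close>
  have "h0 n [0] = 1" using n by (simp add: h0_def)
  moreover have "set [0] \<subseteq> digits n" using n by (simp add: digits_def)
  ultimately show ?thesis using exists_h0_eq_of_word[OF n, of "[0]"] True by auto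
next
  case False
  obtain l where l: "l > 0" "even l" "h dvd n ^ l - 1"
    using exists_even_period[OF h] by blast
  define M where "M = (n ^ l - 1) div h"
  have M: "n ^ l - 1 = h * M" using l(3) by (simp add: M_def)
  have "n ^ l - 1 \<noteq> 0" using period_nonzero n l by blast
  moreover have "n ^ l \<ge> 0" using l(2) by (simp add: zero_le_even_power)
  moreover have "n ^ l \<noteq> 0" using n by auto
  ultimately have "h * M > 0" using M by linarith
  hence M0: "M > 0" using h(1) by (simp add: zero_less_mult_iff)
  \<comment> \<open>From h \<ge> 2 and |n| \<le> 2(|n| - 1), the number M is at most the largest
    contribution of the leading digit in absolute value.\<close>
  have "2 * M \<le> h * M" using M0 h(1) False by (intro mult_right_mono) auto
  hence "2 * M \<le> n ^ l - 1" using M by simp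
  also have "n ^ l = \<bar>n\<bar> ^ l" using l(2) by (simp add: power_even_abs)
  also have "\<dots> - 1 \<le> 2 * ((\<bar>n\<bar> - 1) * \<bar>n\<bar> ^ (l - 1))"
  proof -
    have "\<bar>n\<bar> ^ l = \<bar>n\<bar> * \<bar>n\<bar> ^ (l - 1)" using l(1) by (metis power_minus_mult mult.commute)
    moreover have "\<bar>n\<bar> * \<bar>n\<bar> ^ (l - 1) \<le> (2 * (\<bar>n\<bar> - 1)) * \<bar>n\<bar> ^ (l - 1)"
      using n by (intro mult_right_mono) auto
    ultimately show ?thesis by (simp only: mult.assoc)
  qed
  finally have Mle: "M \<le> (\<bar>n\<bar> - 1) * \<bar>n\<bar> ^ (l - 1)" by simp
  \<comment> \<open>Since l is even, the leading place has odd exponent l - 1 and carries the sign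
    of n. The target value is therefore \<open>sgn n * M\<close>.\<close>
  have sgn_pow: "n ^ (l - 1) = sgn n * \<bar>n\<bar> ^ (l - 1)"
  proof -
    have "odd (l - 1)" using l by simp
    thus ?thesis using n by (cases "n > 0") (auto simp: power_minus_odd sgn_if)
  qed
  have "\<exists>w. length w = l \<and> set w \<subseteq> digits n \<and> word_num n w = sgn n * M"
  proof (rule exists_word_num_top[OF n l(1)])
    have eq: "(\<bar>n\<bar> - 1) * n ^ (l - 1) = sgn n * ((\<bar>n\<bar> - 1) * \<bar>n\<bar> ^ (l - 1))"
      by (simp only: sgn_pow mult.left_commute)
    show "min 0 ((\<bar>n\<bar> - 1) * n ^ (l - 1)) \<le> sgn n * M"
      "sgn n * M \<le> max 0 ((\<bar>n\<bar> - 1) * n ^ (l - 1))"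
      unfolding eq using n M0 Mle by (cases "n > 0"; simp)+
  qed
  then obtain w where w: "length w = l" "set w \<subseteq> digits n" "word_num n w = sgn n * M"
    by blast
  \<comment> \<open>M divides n^l - 1 = h * M, and the gcd ignores the sign of the target; the
    cofactor h is left as \<open>h0\<close>.\<close>
  have "gcd (n ^ length w - 1) (word_num n w) = M"
    using M0 n by (cases "n > 0") (auto simp: w M)
  hence "h0 n w = h" using M0 h(1) by (simp add: h0_def w(1) M abs_mult)
  thus ?thesis using exists_h0_eq_of_word[OF n, of w] w l(1) by auto
qed

section \<open>The sets W(0,h) in terms of \<open>h0\<close>, and principal ideals\<close>

lemma q_val_in_I_set:
  assumes "w \<noteq> []" "set w \<subseteq> digits n"
  shows "q_val n w \<in> I_set n"
proof -
  have "rev w ! (i mod length w) \<in> set (rev w)" for i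
    using assms(1) by (intro nth_mem) simp
  thus ?thesis using assms(2) unfolding I_set_def q_val_def
    by (intro CollectI exI[of _ "\<lambda>i. rev w ! (i mod length w)"]) auto
qed

text \<open>The closed form of q turns q(w) = b/h into an integer equation, whose solvability in b
  is the criterion \<open>h0_dvd_iff\<close>; \<open>q_val_in_I_set\<close> supplies membership in
  I_n.\<close>

lemma W0_eq:
  assumes n: "\<bar>n\<bar> \<ge> 2" and h: "h > 0"
  shows "W0 n h = {w \<in> prim_words n. h0 n w dvd h}"
proof -
  have "q_val n w \<in> Q0 n h \<longleftrightarrow> h0 n w dvd h" if w: "w \<in> prim_words n" for w
  proof -
    have w': "w \<noteq> []" "set w \<subseteq> digits n"
      using w by (auto simp: prim_words_def primitive_def)
    let ?N = "n ^ length w - 1"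
    have N: "?N \<noteq> 0" using period_nonzero n w' by simp
    have N': "real_of_int n ^ length w - 1 \<noteq> 0"
      by (metis N of_int_1 of_int_diff of_int_eq_0_iff of_int_power)
    have "q_val n w = of_int b / of_int h \<longleftrightarrow> h * word_num n w = ?N * b" for b
    proof -
      have "q_val n w = of_int b / of_int h \<longleftrightarrow>
          real_of_int (h * word_num n w) = real_of_int (?N * b)"
        using N' h by (simp add: q_val_closed_form[OF n w'] frac_eq_eq mult_ac)
      thus ?thesis by (simp only: of_int_eq_iff)
    qed
    thus ?thesis
      using q_val_in_I_set[OF w'] h0_dvd_iff[OF n w'(1)] by (auto simp: Q0_def dvd_def)
  qed
  thus ?thesis by (auto simp: W0_def)
qed

lemma down_eq_W0:
  assumes "\<bar>n\<bar> \<ge> 2" "w \<in> prim_words n"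
  shows "down n w = W0 n (h0 n w)"
  using W0_eq[OF assms(1) h0_pos[OF assms(1) prim_words_nonempty[OF assms(2)]]]
  by (simp add: down_def word_le_def)

lemma principal_ideal_iff:
  assumes n: "\<bar>n\<bar> \<ge> 2"
  shows "principal_ideal n W \<longleftrightarrow> (\<exists>h>0. coprime h n \<and> W0 n h = W)"
proof
  assume "principal_ideal n W"
  then obtain w where "w \<in> prim_words n" "W = down n w" by (auto simp: principal_ideal_def)
  thus "\<exists>h>0. coprime h n \<and> W0 n h = W"
    using down_eq_W0[OF n] h0_pos[OF n] coprime_h0 prim_words_nonempty by metis
next
  assume "\<exists>h>0. coprime h n \<and> W0 n h = W"
  then obtain h where h: "h > 0" "coprime h n" "W0 n h = W" by blast
  then obtain w where "w \<in> prim_words n" "h0 n w = h" using exists_h0_eq[OF n] by blast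
  thus "principal_ideal n W"
    using down_eq_W0[OF n] h(3) unfolding principal_ideal_def by metis
qed

section \<open>Rotations of primitive words and finiteness of W(0,h)\<close>

lemma primitive_rotate_inj:
  assumes "primitive w"
  shows "inj_on (\<lambda>i. rotate i w) {..<length w}"
proof -
  have neq: "rotate i w \<noteq> rotate j w" if ij: "i < j" "j < length w" for i j
  proof
    assume eq: "rotate i w = rotate j w"
    define d where "d = j - i"
    have "rotate i (rotate d w) = rotate i w"
      using ij eq by (simp add: d_def rotate_rotate)
    hence "rotate d w = w"
      using inj_fn[OF inj_rotate1, of i] by (auto simp: rotate_def dest: injD)
    moreover have d: "0 < d" "d < length w" using ij by (auto simp: d_def)
    \<comment> \<open>A nontrivial rotation fixing w makes a prefix and the matching suffix commute,
      and commuting words are powers of a common word. Both pieces are nonempty, so w is a power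
      with exponent at least 2.\<close>
    ultimately have "drop d w @ take d w = take d w @ drop d w"
      by (simp add: rotate_drop_take)
    then obtain m k zs where zs: "concat (replicate m zs) = drop d w"
        "concat (replicate k zs) = take d w"
      using comm_append_are_replicate by blast
    have "m \<noteq> 0" "k \<noteq> 0" using zs d by (auto intro!: gr0I)
    moreover have "w = concat (replicate (k + m) zs)"
      by (simp add: replicate_add zs)
    ultimately show False using assms unfolding primitive_def
      by (metis add_mono less_one not_le one_add_one)
  qed
  show ?thesis
    by (intro inj_onI) (metis lessThan_iff linorder_neqE_nat neq)
qed

text \<open>One rotation moves the lowest digit d to the top: n times the new value is the old value
  plus (n^l - 1) * d. The factor n cancels because it is coprime to n^l - 1.\<close>

lemma word_num_rotate_dvd:
  assumes "n ^ length w - 1 dvd h * word_num n w"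
  shows "n ^ length w - 1 dvd h * word_num n (rotate i w)"
proof (induction i)
  case (Suc i)
  define u where "u = rotate i w"
  have lu: "length u = length w" by (simp add: u_def)
  show ?case
  proof (cases u)
    case Nil
    thus ?thesis using lu by simp
  next
    case (Cons d v)
    let ?N = "n ^ length w - 1"
    have lw: "length w = Suc (length v)" using lu Cons by simp
    have "n * word_num n (v @ [d]) = word_num n u + ?N * d"
      by (simp add: Cons lw word_num_append algebra_simps)
    hence "n * (h * word_num n (v @ [d])) = h * word_num n u + ?N * (h * d)"
      by (simp only: mult.left_commute[of n h]) (simp add: algebra_simps)
    hence "?N dvd n * (h * word_num n (v @ [d]))"
      using Suc.IH by (simp add: u_def)
    moreover have "coprime ?N n"
      using coprime_diff_one_left[of "n ^ length w"] lw by simp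
    ultimately have "?N dvd h * word_num n (v @ [d])"
      using coprime_dvd_mult_right_iff by blast
    thus ?thesis using Cons by (simp add: u_def)
  qed
qed (use assms in simp)

lemma length_le_of_h0_dvd:
  assumes n: "\<bar>n\<bar> \<ge> 2" and h: "h > 0" and w: "w \<in> prim_words n" "h0 n w dvd h"
  shows "length w \<le> nat (2 * h + 1)"
proof -
  have w': "w \<noteq> []" "set w \<subseteq> digits n" "primitive w"
    using w(1) by (auto simp: prim_words_def primitive_def)
  let ?N = "n ^ length w - 1"
  have N: "?N \<noteq> 0" using period_nonzero n w' by simp
  \<comment> \<open>\<open>b i\<close> is the numerator over h of the q-value of the i-th
    rotation.\<close>
  define b where "b = (\<lambda>i. h * word_num n (rotate i w) div ?N)"
  have b: "h * word_num n (rotate i w) = ?N * b i" for i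
    using word_num_rotate_dvd w(2) h0_dvd_iff[OF n w'(1)] by (simp add: b_def)
  have "inj_on b {..<length w}"
  proof (rule inj_onI)
    fix i j assume ij: "i \<in> {..<length w}" "j \<in> {..<length w}" "b i = b j"
    hence "h * word_num n (rotate i w) = h * word_num n (rotate j w)" using b by simp
    hence "word_num n (rotate i w) = word_num n (rotate j w)" using h by simp
    hence "rotate i w = rotate j w" using w'(2) by (intro word_num_inj) auto
    thus "i = j" using primitive_rotate_inj[OF w'(3)] ij by (auto dest: inj_onD)
  qed
  moreover have "b ` {..<length w} \<subseteq> {-h..h}"
  proof (rule image_subsetI)
    fix i
    have "\<bar>?N\<bar> * \<bar>b i\<bar> = h * \<bar>word_num n (rotate i w)\<bar>"
      using b[of i] h by (metis abs_mult abs_of_pos)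
    also have "\<dots> \<le> h * \<bar>?N\<bar>"
      using abs_word_num_le_period[of n "rotate i w"] n w'(2) h by (intro mult_left_mono) auto
    finally have "\<bar>b i\<bar> \<le> h" using N by (simp add: mult.commute[of h])
    thus "b i \<in> {-h..h}" by auto
  qed
  \<comment> \<open>The numerators are distinct and lie among the 2h + 1 integers from -h to
    h.\<close>
  ultimately have "card {..<length w} \<le> card {-h..h}"
    by (intro card_inj_on_le) auto
  thus ?thesis by simp
qed

lemma finite_W0:
  assumes n: "\<bar>n\<bar> \<ge> 2" and h: "h > 0"
  shows "finite (W0 n h)"
proof (rule finite_subset)
  show "W0 n h \<subseteq> {w. set w \<subseteq> digits n \<and> length w \<le> nat (2 * h + 1)}"
    using length_le_of_h0_dvd[OF n h] by (auto simp: W0_eq[OF n h] prim_words_def)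
  show "finite {w. set w \<subseteq> digits n \<and> length w \<le> nat (2 * h + 1)}"
    by (intro finite_lists_length_le) (simp add: digits_def)
qed

section \<open>The closure of finite sets and the closed sets\<close>

lemma cl0_finite:
  assumes n: "\<bar>n\<bar> \<ge> 2" and W: "finite W" "W \<noteq> {}" "W \<subseteq> prim_words n"
  obtains h where "h > 0" "coprime h n" "W \<subseteq> W0 n h" "cl0 n W = W0 n h"
    "\<forall>k>0. W \<subseteq> W0 n k \<longrightarrow> W0 n h \<subseteq> W0 n k"
proof -
  define L where "L = Lcm (h0 n ` W)"
  let ?p = "\<Prod>w\<in>W. h0 n w"
  have ne: "w \<noteq> []" if "w \<in> W" for w using that W(3) prim_words_nonempty by blast
  \<comment> \<open>The product of the \<open>h0\<close> values is positive and coprime to n, and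
    its divisor L inherits nonvanishing and coprimality.\<close>
  have dvd: "L dvd ?p" unfolding L_def using W(1) by (auto intro: Lcm_least dvd_prodI)
  have "?p > 0" using ne h0_pos[OF n] by (intro prod_pos) auto
  hence "L \<noteq> 0" using dvd by auto
  moreover have "L \<ge> 0" by (simp add: L_def)
  ultimately have L: "L > 0" by simp
  have "coprime ?p n" using ne coprime_h0 by (intro prod_coprime_left) auto
  hence cop: "coprime L n" using coprime_divisors[OF dvd dvd_refl] by blast
  have sub: "W \<subseteq> W0 n L"
    using W(3) unfolding W0_eq[OF n L] by (auto simp: L_def)
  have least: "W0 n L \<subseteq> W0 n k" if k: "k > 0" "W \<subseteq> W0 n k" for k
  proof -
    \<comment> \<open>W lies in \<open>W0 n k\<close> only if k is a common multiple of the
      \<open>h0\<close> values, hence a multiple of L.\<close>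
    have "L dvd k" using k unfolding L_def by (intro Lcm_least) (auto simp: W0_eq[OF n])
    thus ?thesis using dvd_trans by (auto simp: W0_eq[OF n] L k(1))
  qed
  have "cl0 n W = (LEAST V. W \<subseteq> V \<and> (\<exists>h>0. coprime h n \<and> V = W0 n h))"
    using W by (simp add: cl0_def)
  also have "\<dots> = W0 n L"
    using L cop sub least by (intro Least_equality) auto
  finally show ?thesis using that L cop sub least by blast
qed

theorem theorem5p6:
  fixes n :: int
  assumes "\<bar>n\<bar> \<ge> 2"
  shows "(\<forall>W. W \<subseteq> prim_words n \<longrightarrow>
            ((\<exists>h>0. coprime h n \<and> W0 n h = W) \<longleftrightarrow> principal_ideal n W)) \<and>
         {W. W \<subseteq> prim_words n \<and> closed0 n W} =
           {W. principal_ideal n W} \<union> {{}, prim_words n}"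
proof -
  note n = assms
  have W0_sub: "W0 n h \<subseteq> prim_words n" for h by (auto simp: W0_def)
  have "W \<subseteq> prim_words n \<and> closed0 n W \<longleftrightarrow>
      principal_ideal n W \<or> W = {} \<or> W = prim_words n" for W
  proof (cases "W = {} \<or> infinite W")
    case True
    \<comment> \<open>Finiteness of W(0,h) enters here: an infinite W is not principal and its
      closure is everything, so it is closed only as the whole set. The empty set is not principal,
      as a generator lies in its own ideal.\<close>
    have "\<not> principal_ideal n W" if "infinite W"
      using that finite_W0[OF n] principal_ideal_iff[OF n, of W] by metis
    moreover have "cl0 n W = (if W = {} then {} else prim_words n)"
      using True by (auto simp: cl0_def)
    moreover have "\<not> principal_ideal n {}"
      by (auto simp: principal_ideal_def down_def word_le_def)
    ultimately show ?thesis using True by (auto simp: closed0_def)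
  next
    case False
    hence fin: "finite W" and ne: "W \<noteq> {}" by auto
    show ?thesis
    proof
      assume W: "W \<subseteq> prim_words n \<and> closed0 n W"
      obtain h where "h > 0" "coprime h n" "cl0 n W = W0 n h"
        by (rule cl0_finite[OF n fin ne conjunct1[OF W]])
      hence "principal_ideal n W"
        using W unfolding principal_ideal_iff[OF n] closed0_def by metis
      thus "principal_ideal n W \<or> W = {} \<or> W = prim_words n" ..
    next
      assume W: "principal_ideal n W \<or> W = {} \<or> W = prim_words n"
      hence sub: "W \<subseteq> prim_words n"
        by (auto simp: principal_ideal_def down_def)
      obtain h where h: "h > 0" "coprime h n" "W \<subseteq> W0 n h" "cl0 n W = W0 n h"
          "\<forall>k>0. W \<subseteq> W0 n k \<longrightarrow> W0 n h \<subseteq> W0 n k"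
        by (rule cl0_finite[OF n fin ne sub])
      have "W0 n h \<subseteq> W"
      proof (cases "principal_ideal n W")
        case True
        then obtain k where "k > 0" "W0 n k = W" unfolding principal_ideal_iff[OF n] by blast
        thus ?thesis using h(5) by blast
      next
        case False
        \<comment> \<open>Only W = \<open>prim_words n\<close> remains; \<open>W0_sub\<close>
          settles it without deciding whether that set is finite.\<close>
        thus ?thesis using W ne W0_sub by simp
      qed
      thus "W \<subseteq> prim_words n \<and> closed0 n W"
        using h(3,4) sub by (simp add: closed0_def)
    qed
  qed
  hence "{W. W \<subseteq> prim_words n \<and> closed0 n W} =
      {W. principal_ideal n W} \<union> {{}, prim_words n}"
    by auto
  thus ?thesis by (simp add: principal_ideal_iff[OF n])
qed

end
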